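(* Let $G=(V,E)$ be the complete directed acyclic graph with vertex set $V=\{1,2,\ldots,n\}$ and edge set $E=\{(i,j)\in V\times V\colon i<j\}$, and let $w(i,j)\in\mathbb{R}$ denote the weight of the edge $(i,j)$. This instance of the directed shortest path problem has the constant objective value property (COVP) if and only if there exists a real vector $A=(a_1,\ldots,a_n)$ such that $$w(i,j)=a_j-a_i\qquad\text{for all } i,j\in\{1,\ldots,n\} \text{ with } i<j.$$
   Context: The feasible solutions of the directed shortest path problem are the directed paths in $G$ from vertex $1$ to vertex $n$; the objective value of a path is the sum of the weights of its edges. An instance has the constant objective value property (COVP) if all feasible solutions have the same objective value. *)

theory Defs
  imports "Graph_Theory.Weighted_Graph"
begin

definition complete_dag :: "nat \<Rightarrow> (nat, nat \<times> nat) pre_digraph" where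
  "complete_dag n =
     \<lparr> verts = {1..n},
       arcs = {(i, j). i \<in> {1..n} \<and> j \<in> {1..n} \<and> i < j},
       tail = fst,
       head = snd \<rparr>"

lemma digraph_complete_dag: "digraph (complete_dag n)"
proof
  show "finite (arcs (complete_dag n))"
    by (rule finite_subset[of _ "{1..n} \<times> {1..n}"]) (auto simp: complete_dag_def)
qed (auto simp: complete_dag_def arc_to_ends_def)

(* A solution is the list of arcs of the path; for n = 1 the empty list is the only one. *)
definition sp_feasible :: "nat \<Rightarrow> (nat \<times> nat) list set" where
  "sp_feasible n = {p. pre_digraph.apath (complete_dag n) 1 p n}"

definition sp_objective :: "(nat \<times> nat) weight_fun \<Rightarrow> (nat \<times> nat) list \<Rightarrow> real" where
  "sp_objective w p = wf_digraph.awalk_cost w p"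

definition covp :: "'s set \<Rightarrow> ('s \<Rightarrow> real) \<Rightarrow> bool" where
  "covp F f \<longleftrightarrow> (\<forall>x\<in>F. \<forall>y\<in>F. f x = f y)"

end

theory Submission
  imports Defs
begin

text \<open>
  If \<open>w (i, j) = a j - a i\<close>, the cost of a path telescopes to \<open>a n - a 1\<close>. Conversely,
  comparing the path 1, i, j, ..., n with the path 1, j, ..., n that shortcuts \<open>i\<close> gives
  \<open>w (1, i) + w (i, j) = w (1, j)\<close>, so \<open>a 1 = 0\<close> and \<open>a j = w (1, j)\<close> for \<open>j > 1\<close> works.
\<close>

lemma wf_digraph_complete_dag: "wf_digraph (complete_dag n)"
  by (rule wf_digraph.intro) (auto simp: complete_dag_def)

lemma complete_dag_simps:
  "verts (complete_dag n) = {1..n}"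
  "(i, j) \<in> arcs (complete_dag n) \<longleftrightarrow> 1 \<le> i \<and> i < j \<and> j \<le> n"
  "tail (complete_dag n) = fst"
  "head (complete_dag n) = snd"
  by (auto simp: complete_dag_def)

text \<open>The value of \<open>awalk_cost\<close> does not depend on a graph, but its defining
  equation carries a locale premise; any \<open>complete_dag\<close> discharges it.\<close>

lemma sp_objective_eq_sum_list: "sp_objective w p = sum_list (map w p)"
  by (simp add: sp_objective_def wf_digraph.awalk_cost_def[OF wf_digraph_complete_dag])

text \<open>The start \<open>u\<close> is arbitrary because removing the first arc of a walk moves
  its start to the head of that arc.\<close>

lemma awalk_sum_potential:
  fixes a :: "nat \<Rightarrow> real"
  assumes "\<And>i j. (i, j) \<in> arcs (complete_dag n) \<Longrightarrow> w (i, j) = a j - a i"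
    and "pre_digraph.awalk (complete_dag n) u p v"
  shows "sum_list (map w p) = a v - a u"
  using assms(2)
proof (induction p arbitrary: u)
  case Nil
  then show ?case
    by (simp add: wf_digraph.awalk_Nil_iff[OF wf_digraph_complete_dag])
next
  case (Cons e p)
  obtain i j where e: "e = (i, j)" by (cases e)
  with Cons.prems have "(i, j) \<in> arcs (complete_dag n)" "u = i"
    "pre_digraph.awalk (complete_dag n) j p v"
    by (auto simp: wf_digraph.awalk_Cons_iff[OF wf_digraph_complete_dag] complete_dag_simps)
  from Cons.IH[OF this(3)] assms(1)[OF this(1)] \<open>u = i\<close> e show ?case by simp
qed

lemmas complete_dag_path_simps =
  sp_feasible_def pre_digraph.apath_def pre_digraph.awalk_def pre_digraph.cas.simps
  pre_digraph.awalk_verts.simps complete_dag_simps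

text \<open>This and the next two lemmas supply the paths with one, two and three arcs that the
  converse compares.\<close>

lemma sp_feasible_1:
  assumes "1 < n"
  shows "[(1, n)] \<in> sp_feasible n"
  using assms by (simp add: complete_dag_path_simps)

lemma sp_feasible_2:
  assumes "1 < i" "i < n"
  shows "[(1, i), (i, n)] \<in> sp_feasible n"
  using assms by (simp add: complete_dag_path_simps)

lemma sp_feasible_3:
  assumes "1 < i" "i < j" "j < n"
  shows "[(1, i), (i, j), (j, n)] \<in> sp_feasible n"
  using assms by (simp add: complete_dag_path_simps)

theorem theorem4p4:
  fixes n :: nat and w :: "nat \<times> nat \<Rightarrow> real"
  shows "covp (sp_feasible n) (sp_objective w) \<longleftrightarrow>
    (\<exists>a :: nat \<Rightarrow> real. \<forall>i\<in>{1..n}. \<forall>j\<in>{1..n}. i < j \<longrightarrow> w (i, j) = a j - a i)"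
proof
  assume "covp (sp_feasible n) (sp_objective w)"
  then have cost_eq: "sum_list (map w p) = sum_list (map w q)"
    if "p \<in> sp_feasible n" "q \<in> sp_feasible n" for p q
    using that unfolding covp_def sp_objective_eq_sum_list by blast
  \<comment> \<open>The pair \<open>(1, 1)\<close> is not an arc, so \<open>w (1, 1)\<close> may be
    any number; the potential at the source is set to 0 instead.\<close>
  define a where "a j = (if j = 1 then 0 else w (1, j))" for j
  have "w (i, j) = a j - a i" if "1 \<le> i" "i < j" "j \<le> n" for i j
  proof (cases "i = 1")
    case True
    with that show ?thesis by (simp add: a_def)
  next
    case False
    with that have "1 < i" by simp
    have "w (1, i) + w (i, j) = w (1, j)"
    \<comment> \<open>For \<open>j = n\<close> the path through \<open>i\<close> and
      \<open>j\<close> already ends at \<open>j\<close>, since \<open>(n, n)\<close> is not an arc;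
      the shortcut is then the single arc \<open>(1, n)\<close>.\<close>
    proof (cases "j = n")
      case True
      then show ?thesis
        using cost_eq[OF sp_feasible_2 sp_feasible_1, of i] \<open>1 < i\<close> \<open>i < j\<close> by simp
    next
      case False
      \<comment> \<open>Both paths end with the arc \<open>(j, n)\<close>, whose weight
        cancels.\<close>
      then show ?thesis
        using cost_eq[OF sp_feasible_3 sp_feasible_2, of i j j] \<open>1 < i\<close> that by simp
    qed
    with \<open>1 < i\<close> \<open>i < j\<close> show ?thesis by (simp add: a_def)
  qed
  then show "\<exists>a. \<forall>i\<in>{1..n}. \<forall>j\<in>{1..n}. i < j \<longrightarrow> w (i, j) = a j - a i"
    by (intro exI[of _ a]) simp
next
  assume "\<exists>a :: nat \<Rightarrow> real. \<forall>i\<in>{1..n}. \<forall>j\<in>{1..n}. i < j \<longrightarrow> w (i, j) = a j - a i"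
  then obtain a where
    "\<And>i j. (i, j) \<in> arcs (complete_dag n) \<Longrightarrow> w (i, j) = a j - a i"
    by (auto simp: complete_dag_simps)
  then have "sp_objective w p = a n - a 1" if "p \<in> sp_feasible n" for p
    using awalk_sum_potential[of n w a 1 p n] that
    by (simp add: sp_feasible_def pre_digraph.apath_def sp_objective_eq_sum_list)
  then show "covp (sp_feasible n) (sp_objective w)"
    by (simp add: covp_def)
qed

end
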